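(* Let $\lambda>1$ be fixed and let $D_U,D_V$ be the $n\times n$ symmetric matrices $D_U=W_2^{-1}-W_2^{-1}B-B^TW_2^{-1}+B^TW_2^{-1}B$, $D_V=W_1^{-1}-A^TW_1^{-1}-W_1^{-1}A$, where $A=K_V^0(I+\Sigma_2)^{-1}$, $W_1=K_V^0-K_V^0(I+\Sigma_2)^{-1}K_V^0$, $B=K_U^0(K_U^0+\Sigma_1)^{-1}$, $W_2=K_U^0-K_U^0(K_U^0+\Sigma_1)^{-1}K_U^0$ for given symmetric positive definite $K_U^0,K_V^0,\Sigma_1,\Sigma_2$ with $K_U^0+K_V^0=I$. Let $D_U-\lambda D_V=H\,\mathrm{diag}(b_1,\dots,b_n)\,H^T$ be an eigen-decomposition with $H$ orthogonal. Then the optimal solution of $$\max_{K_U}\ -\mathrm{tr}(D_UK_U)-\lambda\,\mathrm{tr}(D_V(I-K_U))+\ln|K_U|+\lambda\ln|I-K_U|\quad\text{s.t. } 0\prec K_U\prec I$$ is $K_U=H\,\mathrm{diag}(a_1,\dots,a_n)\,H^T$, where for $i=1,\dots,n$, $$a_i=\begin{cases}\dfrac{1}{1+\lambda}, & b_i=0,\\[2mm] \dfrac{(\lambda+1+b_i)-\sqrt{(\lambda+1+b_i)^2-4b_i}}{2b_i}, & b_i\neq0.\end{cases}$$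
   Context: $|M|$ denotes the determinant; $0\prec K_U\prec I$ means $K_U$ and $I-K_U$ are positive definite. *)

theory Defs
  imports "HOL-Analysis.Analysis"
begin

type_synonym 'n rmat = "real^'n^'n"

definition sym_mat :: "'n::finite rmat \<Rightarrow> bool" where
  "sym_mat M \<longleftrightarrow> transpose M = M"

definition pos_def :: "'n::finite rmat \<Rightarrow> bool" where
  "pos_def M \<longleftrightarrow> sym_mat M \<and> (\<forall>x. x \<noteq> 0 \<longrightarrow> x \<bullet> (M *v x) > 0)"

definition diag_mat :: "('n::finite \<Rightarrow> real) \<Rightarrow> 'n rmat" where
  "diag_mat a = (\<chi> i j. if i = j then a i else 0)"

definition feasible :: "'n::finite rmat \<Rightarrow> bool" where
  "feasible K \<longleftrightarrow> pos_def K \<and> pos_def (mat 1 - K)"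

definition objective :: "real \<Rightarrow> 'n::finite rmat \<Rightarrow> 'n rmat \<Rightarrow> 'n rmat \<Rightarrow> real" where
  "objective lam DU DV K =
     - trace (DU ** K) - lam * trace (DV ** (mat 1 - K)) + ln (det K) + lam * ln (det (mat 1 - K))"

definition a_coeff :: "real \<Rightarrow> real \<Rightarrow> real" where
  "a_coeff lam b = (if b = 0 then 1 / (1 + lam)
     else ((lam + 1 + b) - sqrt ((lam + 1 + b)^2 - 4 * b)) / (2 * b))"

end

theory Submission
  imports Defs
begin

text \<open>
  The logarithm of the determinant is strictly concave, so it lies below its tangent at any positive
  definite \<open>P\<close>: \<open>ln |M| \<le> ln |P| + tr (P\<^sup>-\<^sup>1 (M - P))\<close>, with equality only for \<open>M = P\<close>. Scaling by
  \<open>P\<^sup>-\<^sup>1\<^sup>/\<^sup>2\<close> reduces this to \<open>ln |X| \<le> tr X - n\<close>, which the spectral theorem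
  turns into \<open>ln d \<le> d - 1\<close> for the eigenvalues. Taking the tangents of \<open>ln |K|\<close> at
  \<open>P = H diag(a) H\<^sup>T\<close> and of \<open>ln |I - K|\<close> at \<open>I - P\<close>, the objective is bounded by a function that is
  affine in the diagonal entries \<open>m\<^sub>i\<close> of \<open>H\<^sup>T K H\<close>, in which \<open>m\<^sub>i\<close> has slope
  \<open>1/a\<^sub>i - \<lambda>/(1 - a\<^sub>i) - b\<^sub>i\<close>. The \<open>a\<^sub>i\<close> are the roots of this expression in \<open>(0, 1)\<close>.
\<close>

section \<open>Spectral theorem for self-adjoint maps on a subspace\<close>

lemma linear_bound_imp_zero:
  fixes p q :: real
  assumes "\<And>t. t * p + t\<^sup>2 * q \<le> 0" and "0 \<le> p"
  shows "p = 0"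
proof (rule ccontr)
  assume "p \<noteq> 0"
  with assms have p: "p > 0" by simp
  \<comment> \<open>Small enough that \<open>t * \<bar>q\<bar> < p\<close>, so the linear term
    outweighs the quadratic one.\<close>
  define t where "t = p / (\<bar>q\<bar> + 1)"
  have t: "t > 0" "t * (\<bar>q\<bar> + 1) = p" using p by (auto simp: t_def)
  have "t * (p + t * q) \<le> 0"
    using assms(1)[of t] by (simp add: algebra_simps power2_eq_square)
  hence "p + t * q \<le> 0" using t(1) by (simp add: mult_le_0_iff)
  moreover have "t * \<bar>q\<bar> < p" using t by (simp add: algebra_simps)
  moreover have "- (t * q) \<le> t * \<bar>q\<bar>" using t(1) by (simp add: abs_if)
  ultimately show False by linarith
qed

text \<open>A maximiser \<open>v\<close> of \<open>x \<bullet> T x\<close> on the unit sphere of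
  \<open>S\<close> works, with \<open>c\<close> the maximum. The residual
  \<open>w = T v - c v\<close> lies in \<open>S\<close> by invariance, so moving \<open>v\<close> in
  its direction is allowed, and maximality forces \<open>w = 0\<close>.\<close>

lemma self_adjoint_eigenvector:
  fixes T :: "'a::euclidean_space \<Rightarrow> 'a"
  assumes lin: "linear T" and sa: "\<And>x y. x \<bullet> T y = T x \<bullet> y"
    and sub: "subspace S" and inv: "T ` S \<subseteq> S" and nz: "S \<noteq> {0}"
  obtains v c where "v \<in> S" "norm v = 1" "T v = c *\<^sub>R v"
proof -
  interpret T: linear T by (fact lin)
  obtain u where u: "u \<in> S" "u \<noteq> 0" using nz subspace_0[OF sub] by blast
  let ?K = "S \<inter> sphere 0 1"
  have "compact ?K" using closed_subspace[OF sub] by (simp add: closed_Int_compact)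
  moreover have "u /\<^sub>R norm u \<in> ?K" using u sub by (simp add: subspace_scale)
  moreover have "continuous_on ?K (\<lambda>x. x \<bullet> T x)"
    using lin by (intro continuous_intros linear_continuous_on) (simp add: linear_conv_bounded_linear)
  ultimately obtain v where v: "v \<in> ?K" and mx: "\<And>y. y \<in> ?K \<Longrightarrow> y \<bullet> T y \<le> v \<bullet> T v"
    using continuous_attains_sup[of ?K "\<lambda>x. x \<bullet> T x"] by blast
  define c where "c = v \<bullet> T v"
  define w where "w = T v - c *\<^sub>R v"
  have vv: "v \<bullet> v = 1" using v by (simp add: norm_eq_1)
  have wS: "w \<in> S"
    using v inv sub by (auto simp: w_def intro!: subspace_diff subspace_scale)
  \<comment> \<open>Homogeneity carries the bound from the sphere to all of \<open>S\<close>, so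
    that \<open>v + t w\<close> needs no normalisation.\<close>
  have rayleigh: "y \<bullet> T y \<le> c * (y \<bullet> y)" if y: "y \<in> S" for y
  proof (cases "y = 0")
    case True
    then show ?thesis by (simp add: T.zero)
  next
    case False
    have "(y /\<^sub>R norm y) \<bullet> T (y /\<^sub>R norm y) \<le> c"
      unfolding c_def using y sub False by (intro mx) (simp add: subspace_scale)
    then have "(y \<bullet> T y) / (norm y)\<^sup>2 \<le> c"
      by (simp add: T.scale power2_eq_square field_simps)
    then show ?thesis using False by (simp add: field_simps power2_norm_eq_inner)
  qed
  \<comment> \<open>First variation at \<open>v\<close>: the linear coefficient in \<open>t\<close>
    is twice the squared norm of the residual.\<close>
  have "t * (2 * (w \<bullet> w)) + t\<^sup>2 * (w \<bullet> T w - c * (w \<bullet> w)) \<le> 0" for t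
  proof -
    have "v + t *\<^sub>R w \<in> S" using v wS sub by (simp add: subspace_add subspace_scale)
    from rayleigh[OF this]
    have "c + 2 * t * (w \<bullet> T v) + t\<^sup>2 * (w \<bullet> T w) \<le> c * (1 + 2 * t * (w \<bullet> v) + t\<^sup>2 * (w \<bullet> w))"
      using sa[of v w] vv
      by (simp add: T.add T.scale inner_add_left inner_add_right c_def[symmetric] inner_commute
          power2_eq_square algebra_simps)
    moreover have "w \<bullet> T v = w \<bullet> w + c * (w \<bullet> v)"
      by (simp add: w_def inner_diff_right inner_diff_left algebra_simps)
    ultimately show ?thesis by (simp add: algebra_simps)
  qed
  from linear_bound_imp_zero[OF this] have "w = 0" by simp
  with v show ?thesis by (intro that[of v c]) (auto simp: w_def)
qed

text \<open>Induction on the dimension: split off a unit eigenvector \<open>v\<close>. Its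
  orthogonal complement in \<open>S\<close> is again invariant, since
  \<open>v \<bullet> T x = T v \<bullet> x = c (v \<bullet> x)\<close>. Stating the result for
  invariant subspaces is what lets the induction run.\<close>

lemma self_adjoint_orthonormal_eigenbasis:
  fixes T :: "'a::euclidean_space \<Rightarrow> 'a"
  assumes lin: "linear T" and sa: "\<And>x y. x \<bullet> T y = T x \<bullet> y"
    and sub: "subspace S" and inv: "T ` S \<subseteq> S"
  shows "\<exists>B. B \<subseteq> S \<and> pairwise orthogonal B \<and> span B = S
           \<and> (\<forall>x\<in>B. norm x = 1 \<and> (\<exists>c. T x = c *\<^sub>R x))"
  using sub inv
proof (induction "dim S" arbitrary: S rule: less_induct)
  case less
  show ?case
  proof (cases "S = {0}")
    case True
    then show ?thesis by (intro exI[of _ "{}"]) auto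
  next
    case False
    then obtain v c where v: "v \<in> S" "norm v = 1" "T v = c *\<^sub>R v"
      using self_adjoint_eigenvector[OF lin sa] less.prems by metis
    define S' where "S' = S \<inter> {x. v \<bullet> x = 0}"
    have vv: "v \<bullet> v = 1" using v by (simp add: norm_eq_1)
    have sub': "subspace S'"
      unfolding S'_def using less.prems by (intro subspace_inter subspace_hyperplane)
    have inv': "T ` S' \<subseteq> S'"
      using less.prems(2) v(3) by (auto simp: S'_def sa)
    have "v \<notin> S'" using vv by (simp add: S'_def)
    with v(1) have "S' \<subset> S" unfolding S'_def by blast
    then have "dim S' < dim S"
      using less.prems(1) sub' by (intro dim_psubset) (simp add: span_eq_iff[THEN iffD2])
    from less.hyps[OF this sub' inv'] obtain B where
      B: "B \<subseteq> S'" "pairwise orthogonal B" "span B = S'"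
        "\<forall>x\<in>B. norm x = 1 \<and> (\<exists>c. T x = c *\<^sub>R x)" by blast
    have "S \<subseteq> span (insert v B)"
    proof
      fix x assume x: "x \<in> S"
      have "x - (v \<bullet> x) *\<^sub>R v \<in> S'"
        using x v vv less.prems by (auto simp: S'_def inner_diff_right subspace_diff subspace_scale)
      then show "x \<in> span (insert v B)" using B(3) span_breakdown_eq by blast
    qed
    moreover have "span (insert v B) \<subseteq> S"
      using v B(1) less.prems by (intro span_minimal) (auto simp: S'_def)
    moreover have "pairwise orthogonal (insert v B)"
      using B(1,2) by (auto simp: pairwise_insert S'_def orthogonal_def inner_commute)
    ultimately show ?thesis
      using v B by (intro exI[of _ "insert v B"]) (auto simp: S'_def)
  qed
qed

section \<open>Diagonal matrices, congruence, and diagonalization of symmetric matrices\<close>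

lemma matrix_mul_diag_nth:
  "(M ** diag_mat a) $ i $ j = M $ i $ j * a j"
  "(diag_mat a ** M) $ i $ j = a i * M $ i $ j"
  by (simp_all add: matrix_matrix_mult_def diag_mat_def if_distrib if_distribR cong: if_cong)

lemma diag_mat_mult: "diag_mat a ** diag_mat b = diag_mat (\<lambda>i. a i * b i)"
  by (simp add: vec_eq_iff matrix_mul_diag_nth) (simp add: diag_mat_def)

lemma diag_mat_one: "diag_mat (\<lambda>i. 1) = mat 1"
  by (simp add: vec_eq_iff diag_mat_def mat_def)

lemma diag_mat_inner: "x \<bullet> (diag_mat a *v x) = (\<Sum>i\<in>UNIV. a i * (x $ i)\<^sup>2)"
  by (simp add: inner_vec_def matrix_vector_mult_def diag_mat_def if_distribR if_distrib
      power2_eq_square mult_ac cong: if_cong)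

lemma transpose_diag_mat [simp]: "transpose (diag_mat a) = diag_mat a"
  by (auto simp: vec_eq_iff transpose_def diag_mat_def)

lemma det_diag_mat: "det (diag_mat a) = prod a UNIV"
  by (subst det_diagonal) (simp_all add: diag_mat_def)

lemma pos_def_diag_mat:
  assumes "\<And>i. 0 < a i"
  shows "pos_def (diag_mat a)"
proof -
  have "0 < (\<Sum>i\<in>UNIV. a i * (x $ i)\<^sup>2)" if "x \<noteq> 0" for x :: "real^'a"
  proof -
    obtain i where "x $ i \<noteq> 0" using \<open>x \<noteq> 0\<close> by (auto simp: vec_eq_iff)
    then show ?thesis using assms
      by (intro sum_pos2[of _ i]) (auto simp: less_imp_le)
  qed
  then show ?thesis by (simp add: pos_def_def sym_mat_def diag_mat_inner)
qed

lemma inner_congruence: "x \<bullet> ((transpose C ** M ** C) *v x) = (C *v x) \<bullet> (M *v (C *v x))"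
  for M C :: "real^'n::finite^'n"
  by (simp add: matrix_vector_mul_assoc[symmetric] del: transpose_matrix_vector)
    (metis dot_lmul_matrix inner_commute transpose_matrix_vector)

text \<open>The form at \<open>x\<close> is the form of \<open>M\<close> at \<open>C *v x\<close>,
  which is nonzero because \<open>C\<close> is injective.\<close>

lemma pos_def_congruence:
  fixes M C :: "real^'n::finite^'n"
  assumes "pos_def M" "invertible C"
  shows "pos_def (transpose C ** M ** C)"
proof -
  have "C *v x \<noteq> 0" if "x \<noteq> 0" for x
    using assms(2) that by (metis invertible_def matrix_left_invertible_ker)
  then show ?thesis
    using assms(1) unfolding pos_def_def sym_mat_def inner_congruence
    by (simp add: matrix_transpose_mul matrix_mul_assoc)
qed

text \<open>An orthonormal eigenbasis of the whole space has \<open>CARD('n)\<close> elements, so it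
  can be indexed by \<open>'n\<close> and placed in the columns of \<open>Q\<close>; then
  \<open>X ** Q = Q ** diag_mat d\<close> is the eigenvector equation column by column.\<close>

theorem symmetric_matrix_diagonalization:
  fixes X :: "real^'n::finite^'n"
  assumes "sym_mat X"
  obtains Q d where "orthogonal_matrix Q" "X = Q ** diag_mat d ** transpose Q"
proof -
  have "x \<bullet> (X *v y) = (X *v x) \<bullet> y" for x y
    using assms by (metis dot_lmul_matrix sym_mat_def transpose_matrix_vector)
  then obtain B where B: "pairwise orthogonal B" "span B = (UNIV :: (real^'n) set)"
      "\<And>x. x \<in> B \<Longrightarrow> norm x = 1" "\<And>x. x \<in> B \<Longrightarrow> \<exists>c. X *v x = c *\<^sub>R x"
    using self_adjoint_orthonormal_eigenbasis[of "(*v) X" UNIV] by auto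
  have "0 \<notin> B" using B(3) by force
  then have ind: "independent B" using B(1) by (rule pairwise_orthogonal_independent[rotated])
  have "finite B" using ind by (rule independent_imp_finite)
  moreover have "card B = CARD('n)"
    using dim_eq_card_independent[OF ind] B(2) dim_span[of B] by simp
  ultimately obtain f where f: "bij_betw f (UNIV :: 'n set) B"
    by (metis finite finite_same_card_bij)
  have fB: "f i \<in> B" for i using f by (auto simp: bij_betw_def)
  define Q :: "real^'n^'n" where "Q = (\<chi> i j. f j $ i)"
  have col: "column j Q = f j" for j by (simp add: Q_def column_def)
  have Q: "orthogonal_matrix Q"
    using B(1,3) fB f
    by (auto simp: orthogonal_matrix_orthonormal_columns col pairwise_def bij_betw_def inj_eq)
  obtain d where d: "\<And>j. X *v f j = d j *\<^sub>R f j" using B(4)[OF fB] by metis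
  have "X ** Q = Q ** diag_mat d"
  proof -
    have "(X ** Q) $ i $ j = (X *v f j) $ i" for i j
      by (simp add: Q_def matrix_matrix_mult_def matrix_vector_mult_def)
    then show ?thesis by (simp add: vec_eq_iff matrix_mul_diag_nth d) (simp add: Q_def)
  qed
  then have "X = Q ** diag_mat d ** transpose Q"
    using Q by (metis matrix_mul_assoc matrix_mul_rid orthogonal_matrix_def)
  with Q show ?thesis by (rule that)
qed

section \<open>Orthogonal conjugation and tangent bounds for the log-determinant\<close>

lemma orthogonal_conj_cancel:
  fixes H :: "real^'n::finite^'n"
  assumes "orthogonal_matrix H"
  shows "transpose H ** (H ** M ** transpose H) ** H = M"
    and "H ** (transpose H ** M ** H) ** transpose H = M"
  using assms unfolding orthogonal_matrix_def
  by (metis matrix_mul_assoc matrix_mul_lid matrix_mul_rid)+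

lemma det_orthogonal_conj:
  fixes H :: "real^'n::finite^'n"
  assumes "orthogonal_matrix H"
  shows "det (H ** M ** transpose H) = det M"
proof -
  have "det H * det H = 1" using det_orthogonal_matrix[OF assms] by auto
  then show ?thesis by (simp add: det_mul)
qed

lemma trace_orthogonal_conj:
  fixes H :: "real^'n::finite^'n"
  assumes "orthogonal_matrix H"
  shows "trace (H ** M ** transpose H) = trace M"
  using assms
  by (metis matrix_mul_assoc matrix_mul_lid orthogonal_matrix_def trace_mul_sym)

lemma invertible_orthogonal: "orthogonal_matrix H \<Longrightarrow> invertible H"
  by (auto simp: orthogonal_matrix_def invertible_def)

lemma ln_det_le_trace:
  fixes X :: "real^'n::finite^'n"
  assumes "pos_def X"
  shows "det X > 0" "ln (det X) \<le> trace X - real CARD('n)"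
    and "ln (det X) = trace X - real CARD('n) \<Longrightarrow> X = mat 1"
proof -
  obtain Q d where Q: "orthogonal_matrix Q" and X: "X = Q ** diag_mat d ** transpose Q"
    using symmetric_matrix_diagonalization assms unfolding pos_def_def by blast
  have "transpose Q ** X ** Q = diag_mat d" using Q by (simp add: X orthogonal_conj_cancel)
  then have pd: "pos_def (diag_mat d)"
    using pos_def_congruence[OF assms invertible_orthogonal[OF Q]] by simp
  \<comment> \<open>Each eigenvalue is the value of the diagonal form at a coordinate
    vector.\<close>
  have d: "0 < d i" for i
  proof -
    have "0 < axis i 1 \<bullet> (diag_mat d *v axis i 1)"
      using pd by (auto simp: pos_def_def axis_eq_0_iff)
    also have "\<dots> = d i"
      by (simp add: diag_mat_inner axis_def if_distrib[of "\<lambda>x. x\<^sup>2"] if_distrib[of "(*) _"]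
          cong: if_cong)
    finally show ?thesis .
  qed
  have det: "det X = prod d UNIV" by (simp add: X det_orthogonal_conj Q det_diag_mat)
  then show "det X > 0" by (simp add: d prod_pos)
  \<comment> \<open>The slack is a sum of nonnegative terms, so equality makes each term vanish and
    every eigenvalue equal to 1.\<close>
  have gap: "trace X - real CARD('n) - ln (det X) = (\<Sum>i\<in>UNIV. d i - 1 - ln (d i))"
  proof -
    have "trace X = sum d UNIV"
      by (simp add: X trace_orthogonal_conj Q) (simp add: trace_def diag_mat_def)
    moreover have "ln (det X) = (\<Sum>i\<in>UNIV. ln (d i))"
      using d by (simp add: det ln_prod less_imp_neq[symmetric])
    ultimately show ?thesis by (simp add: sum_subtractf)
  qed
  have nonneg: "0 \<le> d i - 1 - ln (d i)" for i using ln_le_minus_one[OF d[of i]] by simp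
  then have "0 \<le> (\<Sum>i\<in>UNIV. d i - 1 - ln (d i))" by (simp add: sum_nonneg)
  then show "ln (det X) \<le> trace X - real CARD('n)" using gap by simp
  assume "ln (det X) = trace X - real CARD('n)"
  then have "d i - 1 - ln (d i) = 0" for i
    using gap nonneg sum_nonneg_eq_0_iff[of UNIV "\<lambda>i. d i - 1 - ln (d i)"] by simp
  then have "d i = 1" for i using ln_eq_minus_one[OF d[of i]] by (simp add: algebra_simps)
  then have "d = (\<lambda>i. 1)" by auto
  then show "X = mat 1" using Q by (simp add: X diag_mat_one orthogonal_matrix_def)
qed

text \<open>This is the tangent bound at \<open>P = H diag(a) H^T\<close> in coordinates: the
  inverse of \<open>P\<close> is diagonal in the basis \<open>H\<close>, so its trace against
  \<open>K\<close> involves only the diagonal entries \<open>m i\<close> and equals the sum of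
  \<open>m i / a i\<close>.\<close>

lemma ln_det_le_tangent:
  fixes K H :: "real^'n::finite^'n"
  assumes K: "pos_def K" and H: "orthogonal_matrix H" and a: "\<And>i. 0 < a i"
  defines "m \<equiv> \<lambda>i. (transpose H ** K ** H) $ i $ i"
  shows "ln (det K) \<le> (\<Sum>i\<in>UNIV. ln (a i) + (m i / a i - 1))" (is "_ \<le> ?R")
    and "ln (det K) = (\<Sum>i\<in>UNIV. ln (a i) + (m i / a i - 1)) \<Longrightarrow>
      K = H ** diag_mat a ** transpose H"
proof -
  \<comment> \<open>In the basis \<open>H\<close>, \<open>r\<close> and \<open>s\<close> represent
    the inverse square root and the square root of \<open>P\<close>.\<close>
  define r where "r = diag_mat (\<lambda>i. 1 / sqrt (a i))"
  define s where "s = diag_mat (\<lambda>i. sqrt (a i))"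
  define M where "M = transpose H ** K ** H"
  define X where "X = r ** M ** r"
  have rs: "r ** s = mat 1" "s ** r = mat 1"
    using a by (simp_all add: r_def s_def diag_mat_mult diag_mat_one less_imp_neq[symmetric])
  have KM: "K = H ** M ** transpose H" by (simp add: M_def orthogonal_conj_cancel H)
  have "pos_def M" unfolding M_def using pos_def_congruence[OF K invertible_orthogonal[OF H]] .
  moreover have "invertible r" using rs by (auto simp: invertible_def)
  ultimately have X: "pos_def X"
    using pos_def_congruence[of M r] by (simp add: X_def r_def)
  have "det K = det M" by (simp add: KM det_orthogonal_conj H)
  moreover have "M = s ** X ** s" unfolding X_def using rs
    by (metis matrix_mul_assoc matrix_mul_lid matrix_mul_rid)
  moreover have ss: "s ** s = diag_mat a"
    using a by (simp add: s_def diag_mat_mult less_imp_le)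
  ultimately have "det K = det X * prod a UNIV"
    by (metis det_diag_mat det_mul mult.commute mult.left_commute)
  then have ln: "ln (det K) = ln (det X) + (\<Sum>i\<in>UNIV. ln (a i))"
    using ln_det_le_trace(1)[OF X] a by (simp add: ln_mult prod_pos ln_prod less_imp_neq[symmetric])
  have "trace X = (\<Sum>i\<in>UNIV. m i / a i)"
    using a by (simp add: trace_def X_def r_def matrix_mul_diag_nth m_def M_def less_imp_le)
  then have R: "?R = (\<Sum>i\<in>UNIV. ln (a i)) + (trace X - real CARD('n))"
    by (simp add: sum.distrib sum_subtractf)
  show "ln (det K) \<le> ?R" using ln R ln_det_le_trace(2)[OF X] by simp
  assume "ln (det K) = ?R"
  then have "X = mat 1" using ln R ln_det_le_trace(3)[OF X] by simp
  then show "K = H ** diag_mat a ** transpose H"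
    using KM \<open>M = s ** X ** s\<close> ss by simp
qed

section \<open>The scalar stationarity equation\<close>

lemma a_coeff_stationary:
  assumes "lam > 0"
  shows "0 < a_coeff lam b" "a_coeff lam b < 1"
    and "1 / a_coeff lam b - lam / (1 - a_coeff lam b) = b"
proof -
  define p where "p = lam + 1 + b"
  define s where "s = sqrt (p\<^sup>2 - 4 * b)"
  \<comment> \<open>Completing the square gives \<open>s > \<bar>p - 2\<bar>\<close>, hence
    \<open>p + s > 2\<close>, which puts the coefficient strictly between 0 and 1.\<close>
  have disc: "p\<^sup>2 - 4 * b = (p - 2)\<^sup>2 + 4 * lam"
    by (simp add: p_def power2_eq_square algebra_simps)
  have s2: "s * s = p\<^sup>2 - 4 * b" using assms by (simp add: s_def disc)
  have "sqrt ((p - 2)\<^sup>2) < s" unfolding s_def disc using assms by (intro real_sqrt_less_mono) simp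
  then have ps: "p + s > 2" by simp
  \<comment> \<open>Rationalising the numerator with \<open>p + s\<close> removes the division by
    \<open>b\<close> and merges the two cases; for \<open>b = 0\<close> one has
    \<open>s = p = lam + 1\<close>.\<close>
  have a: "a_coeff lam b = 2 / (p + s)"
  proof (cases "b = 0")
    case True
    then show ?thesis using assms by (simp add: a_coeff_def s_def p_def field_simps)
  next
    case False
    have "(p - s) * (p + s) = 4 * b"
      using s2 by (simp add: algebra_simps power2_eq_square)
    then have "(p - s) / (2 * b) = 2 / (p + s)" using False ps by (simp add: frac_eq_eq)
    then show ?thesis using False by (simp add: a_coeff_def p_def s_def)
  qed
  show "0 < a_coeff lam b" "a_coeff lam b < 1" using ps by (simp_all add: a)
  have 1: "1 - 2 / (p + s) = (p + s - 2) / (p + s)" using ps by (simp add: field_simps)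
  \<comment> \<open>With \<open>q = p + s\<close> this is the quadratic
    \<open>q^2 - 2 p q + 4 b = 0\<close>, which \<open>q\<close> solves by the choice of
    \<open>s\<close>.\<close>
  have "(p + s - 2) * (p + s - 2 * b) = 2 * lam * (p + s)"
    using s2 by (simp add: p_def algebra_simps power2_eq_square)
  then have "(p + s) / 2 - lam * (p + s) / (p + s - 2) = b"
    using ps by (simp add: field_simps)
  then show "1 / a_coeff lam b - lam / (1 - a_coeff lam b) = b" by (simp add: a 1)
qed

section \<open>Matrix identities and the optimality argument\<close>

lemma matrix_diff_ldistrib: "A ** (B - C) = A ** B - A ** C"
  for A :: "'a::ring_1^'n^'m"
  by (simp add: vec_eq_iff matrix_matrix_mult_def right_diff_distrib sum_subtractf)

lemma matrix_diff_rdistrib: "(A - B) ** C = A ** C - B ** C"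
  for A :: "'a::ring_1^'n^'m"
  by (simp add: vec_eq_iff matrix_matrix_mult_def left_diff_distrib sum_subtractf)

lemma matrix_add_rdistrib: "(A + B) ** C = A ** C + B ** C"
  for A :: "'a::semiring_1^'n^'m"
  by (simp add: vec_eq_iff matrix_matrix_mult_def distrib_right sum.distrib)

lemma orthogonal_conj_one_minus:
  fixes H M :: "real^'n::finite^'n"
  assumes "orthogonal_matrix H"
  shows "transpose H ** (mat 1 - M) ** H = mat 1 - transpose H ** M ** H"
    and "mat 1 - H ** M ** transpose H = H ** (mat 1 - M) ** transpose H"
  using assms
  by (simp_all add: orthogonal_matrix_def matrix_diff_ldistrib matrix_diff_rdistrib)

theorem theorem5:
  fixes lam :: real
    and KU0 KV0 \<Sigma>1 \<Sigma>2 A B W1 W2 DU DV H :: "real^'n::finite^'n"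
    and b :: "'n \<Rightarrow> real"
  assumes lam: "lam > 1"
    and pd: "pos_def KU0" "pos_def KV0" "pos_def \<Sigma>1" "pos_def \<Sigma>2"
    and sumI: "KU0 + KV0 = mat 1"
    and A_def: "A = KV0 ** matrix_inv (mat 1 + \<Sigma>2)"
    and W1_def: "W1 = KV0 - KV0 ** matrix_inv (mat 1 + \<Sigma>2) ** KV0"
    and B_def: "B = KU0 ** matrix_inv (KU0 + \<Sigma>1)"
    and W2_def: "W2 = KU0 - KU0 ** matrix_inv (KU0 + \<Sigma>1) ** KU0"
    and DU_def: "DU = matrix_inv W2 - matrix_inv W2 ** B - transpose B ** matrix_inv W2
                      + transpose B ** matrix_inv W2 ** B"
    and DV_def: "DV = matrix_inv W1 - transpose A ** matrix_inv W1 - matrix_inv W1 ** A"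
    and H: "orthogonal_matrix H"
    and eig: "DU - lam *\<^sub>R DV = H ** diag_mat b ** transpose H"
  shows "feasible (H ** diag_mat (\<lambda>i. a_coeff lam (b i)) ** transpose H)
       \<and> (\<forall>K. feasible K \<longrightarrow>
             objective lam DU DV K \<le> objective lam DU DV (H ** diag_mat (\<lambda>i. a_coeff lam (b i)) ** transpose H))
       \<and> (\<forall>K. feasible K \<and>
             objective lam DU DV K = objective lam DU DV (H ** diag_mat (\<lambda>i. a_coeff lam (b i)) ** transpose H)
             \<longrightarrow> K = H ** diag_mat (\<lambda>i. a_coeff lam (b i)) ** transpose H)"
proof -
  define a where "a i = a_coeff lam (b i)" for i
  define P where "P = H ** diag_mat a ** transpose H"
  define m where "m M i = (transpose H ** M ** H) $ i $ i" for M :: "real^'n^'n" and i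
  have a: "0 < a i" "0 < 1 - a i" "1 / a i - lam / (1 - a i) = b i" for i
    using a_coeff_stationary[of lam "b i"] lam by (simp_all add: a_def)
  have "mat 1 - diag_mat a = diag_mat (\<lambda>i. 1 - a i)"
    by (simp add: vec_eq_iff diag_mat_def mat_def)
  then have IP: "mat 1 - P = H ** diag_mat (\<lambda>i. 1 - a i) ** transpose H"
    unfolding P_def orthogonal_conj_one_minus(2)[OF H] by simp
  have "invertible (transpose H)" using H by (simp add: invertible_orthogonal)
  then have feasP: "feasible P"
    unfolding feasible_def IP unfolding P_def
    using pos_def_congruence[of _ "transpose H"] a by (simp add: pos_def_diag_mat)
  define c where "c = lam * trace DV"
  \<comment> \<open>Substituting the eigen-decomposition for \<open>DU\<close> cancels the two terms
    \<open>lam * trace (DV ** K)\<close>; the rest of the linear part is the constant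
    \<open>c\<close> and a sum over the \<open>m K i\<close>.\<close>
  have obj: "objective lam DU DV K =
      - c - (\<Sum>i\<in>UNIV. b i * m K i) + ln (det K) + lam * ln (det (mat 1 - K))" for K
  proof -
    have DU: "DU = lam *\<^sub>R DV + H ** diag_mat b ** transpose H" using eig by (simp add: algebra_simps)
    have "trace (H ** diag_mat b ** transpose H ** K) = trace (diag_mat b ** (transpose H ** K ** H))"
      by (metis matrix_mul_assoc trace_mul_sym)
    also have "\<dots> = (\<Sum>i\<in>UNIV. b i * m K i)" by (simp add: trace_def matrix_mul_diag_nth m_def)
    finally have "trace (DU ** K) = lam * trace (DV ** K) + (\<Sum>i\<in>UNIV. b i * m K i)"
      by (simp add: DU matrix_add_rdistrib trace_add scalar_matrix_assoc[symmetric])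
        (simp add: trace_def sum_distrib_left)
    then show ?thesis
      by (simp add: objective_def c_def matrix_diff_ldistrib trace_sub algebra_simps)
  qed
  \<comment> \<open>\<open>G1\<close> and \<open>G2\<close> are the tangents at \<open>P\<close> and
    \<open>I - P\<close>, evaluated at \<open>K\<close> and \<open>I - K\<close>.\<close>
  define G1 where "G1 K = (\<Sum>i\<in>UNIV. ln (a i) + (m K i / a i - 1))" for K
  define G2 where "G2 K = (\<Sum>i\<in>UNIV. ln (1 - a i) + ((1 - m K i) / (1 - a i) - 1))" for K
  have m1: "(transpose H ** (mat 1 - K) ** H) $ i $ i = 1 - m K i" for K i
    by (simp add: orthogonal_conj_one_minus(1)[OF H] m_def) (simp add: mat_def)
  have G1: "ln (det K) \<le> G1 K" "ln (det K) = G1 K \<Longrightarrow> K = P"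
    and G2: "ln (det (mat 1 - K)) \<le> G2 K" if "feasible K" for K
    using ln_det_le_tangent[of K H a] ln_det_le_tangent(1)[of "mat 1 - K" H "\<lambda>i. 1 - a i"]
      that H a m1
    by (simp_all add: feasible_def G1_def G2_def P_def m_def)
  define V where "V = - c + (\<Sum>i\<in>UNIV. ln (a i) + lam * ln (1 - a i) - b i * a i)"
  \<comment> \<open>By stationarity the slope in every \<open>m K i\<close> is zero, so the affine
    upper bound is constant in \<open>K\<close>.\<close>
  have bound: "- c - (\<Sum>i\<in>UNIV. b i * m K i) + G1 K + lam * G2 K = V" for K
  proof -
    have "- (b i * x) + (ln (a i) + (x / a i - 1))
        + lam * (ln (1 - a i) + ((1 - x) / (1 - a i) - 1))
        = ln (a i) + lam * ln (1 - a i) - b i * a i" for i x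
    proof -
      \<comment> \<open>Expanding around \<open>x = a i\<close> exposes the common factor
        \<open>x - a i\<close>, whose coefficient is \<open>b i\<close> by
        \<open>a(3)\<close>.\<close>
      have lins: "x / a i - 1 = (x - a i) * (1 / a i)"
          "(1 - x) / (1 - a i) - 1 = - ((x - a i) * (1 / (1 - a i)))"
        using a[of i] by (simp_all add: field_simps)
      have "(x / a i - 1) + lam * ((1 - x) / (1 - a i) - 1)
          = (x - a i) * (1 / a i - lam / (1 - a i))"
        unfolding lins by (simp add: algebra_simps)
      then show ?thesis by (simp add: a(3) algebra_simps)
    qed
    then have "(\<Sum>i\<in>UNIV. - (b i * m K i) + (ln (a i) + (m K i / a i - 1))
        + lam * (ln (1 - a i) + ((1 - m K i) / (1 - a i) - 1))) = V + c"
      unfolding V_def by (simp only:)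
    then have "- (\<Sum>i\<in>UNIV. b i * m K i) + G1 K + lam * G2 K = V + c"
      unfolding G1_def G2_def by (simp only: sum.distrib sum_negf sum_distrib_left[symmetric])
    then show ?thesis by simp
  qed
  have mP: "m P i = a i" for i
    by (simp add: m_def P_def orthogonal_conj_cancel H) (simp add: diag_mat_def)
  have "det P = prod a UNIV" "det (mat 1 - P) = (\<Prod>i\<in>UNIV. 1 - a i)"
    unfolding IP unfolding P_def by (simp_all add: det_orthogonal_conj H det_diag_mat)
  \<comment> \<open>Both tangents touch at \<open>P\<close>, so \<open>V\<close> is attained
    there.\<close>
  then have "ln (det P) = G1 P" "ln (det (mat 1 - P)) = G2 P"
    using a by (simp_all add: G1_def G2_def mP ln_prod less_imp_neq[symmetric])
  then have objP: "objective lam DU DV P = V" using obj[of P] bound[of P] by simp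
  \<comment> \<open>Only the second logarithm is replaced by its tangent. Keeping the slack of the
    first gives uniqueness: the value \<open>V\<close> forces \<open>ln (det K) = G1 K\<close>,
    hence \<open>K = P\<close>.\<close>
  have gap: "objective lam DU DV K \<le> V - (G1 K - ln (det K))" if "feasible K" for K
  proof -
    have "lam * ln (det (mat 1 - K)) \<le> lam * G2 K" using G2[OF that] lam by simp
    then show ?thesis using obj[of K] bound[of K] by simp
  qed
  have "objective lam DU DV K \<le> objective lam DU DV P" if "feasible K" for K
    using gap[OF that] G1(1)[OF that] objP by simp
  moreover have "K = P" if "feasible K" "objective lam DU DV K = objective lam DU DV P" for K
    using gap[OF that(1)] G1[OF that(1)] objP that(2) by simp
  ultimately show ?thesis using feasP unfolding P_def a_def by blast
qed

end
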